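(* Let $0<b<1$, $\alpha\in(0,2]$ and $a=b^{-\alpha}$ (that is, $ab^{\alpha}=1$). Consider the additive first order autoregressive (AR(1)) scheme $$X_n=bX_{n-1}+\varepsilon_n,\qquad n>0 \text{ integer},$$ where $\{\varepsilon_n\}$ is an innovation sequence of i.i.d. random variables. Let $\{Z(t),t\ge0\}$ be a Lévy process, and suppose that $X_0\stackrel{d}{=}Z(1)$ and $\varepsilon_n\stackrel{d}{=}bZ(b^{-\alpha}-1)$ for all $n$. Then the AR(1) scheme is marginally stationary with semi-stable$(a,b)$ marginals if $\{Z(t)\}$ is $(b^{-\alpha},\tfrac1\alpha)$-semi-selfsimilar. Conversely, $\{Z(t)\}$ is $(b^{-\alpha},\tfrac1\alpha)$-semi-selfsimilar and the marginals are semi-stable$(a,b)$ if the AR(1) scheme is marginally stationary.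
   Context: A Lévy process is a real-valued process $\{Z(t),t\ge0\}$ with $Z(0)=0$ having stationary and independent increments. Marginally stationary means that all the $X_n$ have the same distribution; this common distribution is the marginal of the scheme. Semi-stable law: let $0<b<1<a$, where $a$ and $b$ are connected by $ab^{\alpha}=1$, $\alpha\in(0,2]$. A characteristic function $f$ without zeros (and the corresponding probability distribution on $\mathbf{R}$) is semi-stable$(a,b)$ if $f(u)=\{f(bu)\}^{a}$ for all $u\in\mathbf{R}$. Here $\{f(u)\}^{s}$ means $\exp(s\log f(u))$, with $\log f$ the continuous logarithm of $f$ satisfying $\log f(0)=0$. Semi-selfsimilar process: a process $\{X(t),t\ge0\}$ is semi-selfsimilar if for some $c>0$ there is a unique $H>0$ such that $\{X(ct)\}\stackrel{d}{=}\{c^{H}X(t)\}$. One then says that $\{X(t)\}$ is $(c,H)$-semi-selfsimilar, where $c$ is called the epoch and $H$ the exponent. Here $\stackrel{d}{=}$ between processes means equality of finite-dimensional distributions, and between random variables equality in distribution. Semi-stability and semi-selfsimilarity are considered in the strict sense only.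
   Formalization: The Lévy process is also required to be continuous in probability, and in the converse semi-selfsimilarity is claimed only if Z is not almost surely zero at all times (for Z = 0 the exponent is not unique); without these the claim is false. *)

theory Defs
  imports "HOL-Probability.Probability"
begin

section \<open>Processes indexed by nonnegative time\<close>

text \<open>A process on a probability space \<open>N\<close> is a function \<open>Z :: real \<Rightarrow> 'a \<Rightarrow> real\<close> of which only
  the values at times \<open>t \<ge> 0\<close> matter.\<close>

definition equal_fdds ::
  "'a measure \<Rightarrow> (real \<Rightarrow> 'a \<Rightarrow> real) \<Rightarrow> 'b measure \<Rightarrow> (real \<Rightarrow> 'b \<Rightarrow> real) \<Rightarrow> bool" where
  "equal_fdds M X N Y \<longleftrightarrow>
     (\<forall>T. finite T \<and> T \<subseteq> {0..} \<longrightarrow>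
        distr M (PiM T (\<lambda>_. borel)) (\<lambda>\<omega>. \<lambda>t\<in>T. X t \<omega>) =
        distr N (PiM T (\<lambda>_. borel)) (\<lambda>\<omega>. \<lambda>t\<in>T. Y t \<omega>))"

text \<open>Continuity in probability, the last clause, is part of the standard notion of a Levy process.
  Without it the one-dimensional characteristic functions need not satisfy
  \<open>\<phi>\<^sub>t = \<phi>\<^sub>1\<^sup>t\<close>: a discontinuous additive function of \<open>t\<close> is a deterministic process with stationary
  independent increments.  No path regularity is required, and
  \<open>Z 0 = 0\<close> only almost surely.\<close>

definition levy_process :: "'a measure \<Rightarrow> (real \<Rightarrow> 'a \<Rightarrow> real) \<Rightarrow> bool" where
  "levy_process N Z \<longleftrightarrow>
     prob_space N \<and>
     (\<forall>t\<ge>0. Z t \<in> borel_measurable N) \<and>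
     (AE \<omega> in N. Z 0 \<omega> = 0) \<and>
     (\<forall>s\<ge>0. \<forall>t\<ge>0. distr N borel (\<lambda>\<omega>. Z (s + t) \<omega> - Z s \<omega>) =
                   distr N borel (\<lambda>\<omega>. Z t \<omega> - Z 0 \<omega>)) \<and>
     (\<forall>(n::nat) (t::nat \<Rightarrow> real). 0 \<le> t 0 \<and> (\<forall>i<n. t i \<le> t (Suc i)) \<longrightarrow>
        prob_space.indep_vars N (\<lambda>_. borel) (\<lambda>i \<omega>. Z (t (Suc i)) \<omega> - Z (t i) \<omega>) {..<n}) \<and>
     (\<forall>s\<ge>0. \<forall>e>0. ((\<lambda>t. measure N {\<omega> \<in> space N. \<bar>Z t \<omega> - Z s \<omega>\<bar> > e}) \<longlongrightarrow> 0)
                    (at s within {0..}))"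

text \<open>Uniqueness of \<open>H\<close> is part of the definition; it excludes \<open>c = 1\<close> and the zero process, for
  both of which every \<open>H > 0\<close> satisfies the scaling relation.\<close>

definition semi_selfsimilar :: "'a measure \<Rightarrow> (real \<Rightarrow> 'a \<Rightarrow> real) \<Rightarrow> real \<Rightarrow> real \<Rightarrow> bool" where
  "semi_selfsimilar N Z c H \<longleftrightarrow>
     c > 0 \<and> H > 0 \<and>
     equal_fdds N (\<lambda>t. Z (c * t)) N (\<lambda>t \<omega>. c powr H * Z t \<omega>) \<and>
     (\<forall>H'>0. equal_fdds N (\<lambda>t. Z (c * t)) N (\<lambda>t \<omega>. c powr H' * Z t \<omega>) \<longrightarrow> H' = H)"


section \<open>Semi-stable laws\<close>

definition continuous_log :: "(real \<Rightarrow> complex) \<Rightarrow> real \<Rightarrow> complex" where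
  "continuous_log f = (THE L. continuous_on UNIV L \<and> L 0 = 0 \<and> (\<forall>u. exp (L u) = f u))"

lemma continuous_log_ex1:
  assumes cont: "continuous_on UNIV f" and nz: "\<And>u. f u \<noteq> 0" and f0: "f 0 = 1"
  shows "\<exists>!L. continuous_on UNIV L \<and> L 0 = 0 \<and> (\<forall>u::real. exp (L u) = (f u :: complex))"
proof (rule ex_ex1I)
  obtain g where g: "continuous_on UNIV g" "\<And>u. f u = exp (g u)"
    using continuous_logarithm_on_contractible[OF cont convex_imp_contractible[OF convex_UNIV]] nz
    by (metis UNIV_I)
  have "exp (g 0) = 1" using g(2)[of 0] f0 by simp
  then have "continuous_on UNIV (\<lambda>u. g u - g 0) \<and> g 0 - g 0 = 0 \<and> (\<forall>u. exp (g u - g 0) = f u)"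
    using g by (auto simp: exp_diff intro!: continuous_intros)
  then show "\<exists>L. continuous_on UNIV L \<and> L 0 = 0 \<and> (\<forall>u. exp (L u) = f u)"
    by (intro exI[of _ "\<lambda>u. g u - g 0"]) auto
next
  fix L K :: "real \<Rightarrow> complex"
  assume L: "continuous_on UNIV L \<and> L 0 = 0 \<and> (\<forall>u. exp (L u) = f u)"
    and K: "continuous_on UNIV K \<and> K 0 = 0 \<and> (\<forall>u. exp (K u) = f u)"
  define h where "h u = (L u - K u) / (2 * of_real pi * \<i>)" for u
  have hint: "h u \<in> \<int>" for u
  proof -
    have "exp (L u) = exp (K u)" using L K by simp
    then obtain n :: int where "L u = K u + of_int (2 * n) * of_real pi * \<i>"
      by (auto simp: exp_eq)
    then show ?thesis by (simp add: h_def)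
  qed
  have "continuous_on UNIV h"
    unfolding h_def using L K by (intro continuous_intros) auto
  then have "h constant_on UNIV"
  proof (rule continuous_discrete_range_constant[OF connected_UNIV])
    fix x :: real
    have "1 \<le> norm (h y - h x)" if "h y \<noteq> h x" for y
    proof -
      obtain m n :: int where "h x = of_int m" "h y = of_int n"
        using hint[of x] hint[of y] by (auto elim!: Ints_cases)
      moreover from this that have "n \<noteq> m" by auto
      ultimately have "norm (h y - h x) = real_of_int \<bar>n - m\<bar>"
        by (metis norm_of_int of_int_abs of_int_diff)
      with \<open>n \<noteq> m\<close> show ?thesis by linarith
    qed
    then show "\<exists>e>0. \<forall>y. y \<in> UNIV \<and> h y \<noteq> h x \<longrightarrow> e \<le> norm (h y - h x)"
      by (intro exI[of _ 1]) auto
  qed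
  then have "h u = h 0" for u by (auto simp: constant_on_def)
  then show "L = K" using L K by (auto simp: h_def fun_eq_iff)
qed

definition cf_power :: "(real \<Rightarrow> complex) \<Rightarrow> real \<Rightarrow> real \<Rightarrow> complex" where
  "cf_power f s u = exp (of_real s * continuous_log f u)"

definition semi_stable :: "real \<Rightarrow> real \<Rightarrow> real measure \<Rightarrow> bool" where
  "semi_stable a b \<mu> \<longleftrightarrow>
     0 < b \<and> b < 1 \<and> 1 < a \<and> (\<exists>\<alpha>. 0 < \<alpha> \<and> \<alpha> \<le> 2 \<and> a * b powr \<alpha> = 1) \<and>
     real_distribution \<mu> \<and>
     (\<forall>u. char \<mu> u \<noteq> 0) \<and>
     (\<forall>u. char \<mu> u = cf_power (char \<mu>) a (b * u))"


section \<open>First order autoregression\<close>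

text \<open>The innovations are \<open>\<epsilon> 1, \<epsilon> 2, \<dots>\<close>; the value \<open>\<epsilon> 0\<close> is irrelevant.  As usual for
  an innovation sequence, \<open>\<epsilon> n\<close> is independent of \<open>X (n - 1)\<close>; this holds in particular when \<open>X 0\<close> is
  independent of the whole sequence.\<close>

definition ar1_scheme ::
  "'a measure \<Rightarrow> real \<Rightarrow> (nat \<Rightarrow> 'a \<Rightarrow> real) \<Rightarrow> (nat \<Rightarrow> 'a \<Rightarrow> real) \<Rightarrow> bool" where
  "ar1_scheme M b X \<epsilon> \<longleftrightarrow>
     prob_space M \<and>
     (\<forall>n. X n \<in> borel_measurable M) \<and>
     prob_space.indep_vars M (\<lambda>_. borel) \<epsilon> {1..} \<and>
     (\<forall>m\<ge>1. \<forall>n\<ge>1. distr M borel (\<epsilon> m) = distr M borel (\<epsilon> n)) \<and>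
     (\<forall>n\<ge>1. prob_space.indep_var M borel (X (n - 1)) borel (\<epsilon> n)) \<and>
     (\<forall>n\<ge>1. AE \<omega> in M. X n \<omega> = b * X (n - 1) \<omega> + \<epsilon> n \<omega>)"

definition marginally_stationary :: "'a measure \<Rightarrow> (nat \<Rightarrow> 'a \<Rightarrow> real) \<Rightarrow> bool" where
  "marginally_stationary M X \<longleftrightarrow> (\<forall>m n. distr M borel (X m) = distr M borel (X n))"

end

theory Submission
  imports Defs
begin

text \<open>The characteristic function of \<open>Z t\<close> is \<open>exp (t * L u)\<close>, where \<open>L\<close> is the continuous logarithm
  of the characteristic function \<open>\<phi>\<close> of \<open>Z 1\<close>.  Given that \<open>X (n - 1)\<close> has the law of \<open>Z 1\<close>, the
  characteristic function of \<open>X n\<close> at \<open>u\<close> is \<open>exp (L (b * u)) * exp ((a - 1) * L (b * u))\<close>, that is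
  \<open>exp (a * L (b * u))\<close>, the value at \<open>b * u\<close> of the characteristic function of \<open>Z a\<close>.  Hence
  stationarity, semi-stability of \<open>Z 1\<close>, and equality in law of \<open>b * Z a\<close> and \<open>Z 1\<close> all say that
  \<open>a * L (b * u) = L u\<close>.  This identity scales all increments at once, and by independence of
  increments it carries over to the finite-dimensional distributions.\<close>

section \<open>Continuous logarithms\<close>

text \<open>Uniqueness of the continuous logarithm in usable form: every identity between logarithms
  below is obtained by exhibiting a continuous candidate that vanishes at 0.\<close>

lemma continuous_logI:
  assumes L: "continuous_on UNIV L" "L 0 = 0" "\<And>u. exp (L u) = f u"
  shows "continuous_log f = L"
proof -
  have f: "f = (\<lambda>u. exp (L u))" using L(3) by auto
  have "\<exists>!K. continuous_on UNIV K \<and> K 0 = 0 \<and> (\<forall>u::real. exp (K u) = f u)"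
    by (rule continuous_log_ex1) (use L in \<open>auto simp: f intro!: continuous_intros\<close>)
  then show ?thesis
    unfolding continuous_log_def by (rule the1_equality) (use L in auto)
qed

lemma continuous_log:
  assumes "continuous_on UNIV f" "\<And>u. f u \<noteq> 0" "f 0 = 1"
  shows "continuous_on UNIV (continuous_log f)" "continuous_log f 0 = 0"
    "exp (continuous_log f u) = f u"
  using theI'[OF continuous_log_ex1[OF assms]] by (simp_all add: continuous_log_def)

section \<open>Characteristic functions\<close>

lemma char_distr_scale:
  assumes "Y \<in> borel_measurable N"
  shows "char (distr N borel (\<lambda>\<omega>. c * Y \<omega>)) u = char (distr N borel Y) (c * u)"
  using assms by (simp add: char_def integral_distr mult_ac)

lemma distr_eq_iff_char:
  fixes X :: "'a \<Rightarrow> real" and Y :: "'b \<Rightarrow> real"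
  assumes "prob_space M" "prob_space N" "X \<in> borel_measurable M" "Y \<in> borel_measurable N"
  shows "distr M borel X = distr N borel Y \<longleftrightarrow>
    (\<forall>u. char (distr M borel X) u = char (distr N borel Y) u)"
  using assms by (auto intro!: Levy_uniqueness prob_space.real_distribution_distr)

text \<open>Beyond the threshold \<open>e\<close> the trivial bound 2 applies, below it the
  Lipschitz bound of the exponential at 0.\<close>

lemma norm_iexp_minus_1_le:
  fixes x e :: real
  assumes "e \<ge> 0"
  shows "norm (iexp (u * x) - 1) \<le> \<bar>u\<bar> * e + 2 * indicator {y. \<bar>y\<bar> > e} x"
proof (cases "\<bar>x\<bar> > e")
  case True
  have "norm (iexp (u * x) - 1) \<le> norm (iexp (u * x)) + norm (1::complex)"
    by (rule norm_triangle_ineq4)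
  also have "\<dots> = 2" by simp
  finally show ?thesis using True assms by (simp add: add_increasing)
next
  case False
  have "norm (iexp (u * x) - 1) \<le> \<bar>u * x\<bar>"
    using iexp_approx1[of "u * x" 0] by simp
  also have "\<dots> \<le> \<bar>u\<bar> * e" using False by (auto simp: abs_mult intro!: mult_left_mono)
  finally show ?thesis using False by simp
qed

text \<open>The pointwise bound, integrated. It makes quantitative that variables tending to 0 in
  probability have characteristic functions tending to 1.\<close>

lemma (in prob_space) norm_char_minus_1_le:
  fixes Y :: "'a \<Rightarrow> real"
  assumes [measurable]: "random_variable borel Y" and e: "e \<ge> 0"
  shows "norm (char (distr M borel Y) u - 1) \<le> \<bar>u\<bar> * e + 2 * prob {\<omega> \<in> space M. \<bar>Y \<omega>\<bar> > e}"
proof -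
  have int: "integrable M (\<lambda>\<omega>. iexp (u * Y \<omega>))"
    using integrable_iexp[of "\<lambda>\<omega>. complex_of_real (u * Y \<omega>)"] by simp
  have ind: "integrable M (\<lambda>\<omega>. indicator {y. \<bar>y\<bar> > e} (Y \<omega>) :: real)"
    by (rule integrable_const_bound[of _ 1]) (auto simp: indicator_def)
  have "char (distr M borel Y) u - 1 = (CLINT \<omega>|M. iexp (u * Y \<omega>) - 1)"
    using int by (simp add: char_def integral_distr prob_space)
  also have "norm \<dots> \<le> (LINT \<omega>|M. \<bar>u\<bar> * e + 2 * indicator {y. \<bar>y\<bar> > e} (Y \<omega>))"
    by (rule order_trans[OF integral_norm_bound integral_mono])
      (use int ind norm_iexp_minus_1_le[OF e] in auto)
  also have "\<dots> = \<bar>u\<bar> * e + 2 * (LINT \<omega>|M. indicator {y. \<bar>y\<bar> > e} (Y \<omega>))"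
    using ind by (simp add: prob_space)
  also have "(LINT \<omega>|M. indicator {y. \<bar>y\<bar> > e} (Y \<omega>)) = (LINT \<omega>|M. indicator {\<omega> \<in> space M. \<bar>Y \<omega>\<bar> > e} \<omega>)"
    by (intro Bochner_Integration.integral_cong) (auto simp: indicator_def)
  also have "\<dots> = prob {\<omega> \<in> space M. \<bar>Y \<omega>\<bar> > e}"
    by simp
  finally show ?thesis .
qed

text \<open>Uniqueness of characteristic functions, applied to \<open>Y\<close> and the constant
  0.\<close>

lemma (in prob_space) AE_eq_0_if_char_eq_1:
  fixes Y :: "'a \<Rightarrow> real"
  assumes [measurable]: "random_variable borel Y"
    and "\<And>u. char (distr M borel Y) u = 1"
  shows "AE \<omega> in M. Y \<omega> = 0"
proof -
  have "char (distr M borel (\<lambda>_. 0::real)) u = 1" for u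
    by (simp add: char_def integral_distr prob_space del: distr_const)
  then have eq: "distr M borel Y = distr M borel (\<lambda>_. 0)"
    using assms by (subst distr_eq_iff_char[OF prob_space_axioms prob_space_axioms]) auto
  have "AE x in distr M borel (\<lambda>_. 0::real). x = 0" by (subst AE_distr_iff) auto
  then have "AE x in distr M borel Y. x = 0" unfolding eq .
  then show ?thesis by (subst (asm) AE_distr_iff) auto
qed

text \<open>Iterating the invariance moves the argument to \<open>r ^ n * u\<close>, which tends to
  0, where the characteristic function is continuous with value 1.\<close>

lemma (in real_distribution) char_eq_1_if_scale_invariant:
  assumes r: "0 < r" "r < 1" and inv: "\<And>u. char M (r * u) = char M u"
  shows "char M u = 1"
proof -
  have "char M (r ^ n * u) = char M u" for n
    by (induction n) (auto simp: inv mult.assoc)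
  moreover have "(\<lambda>n. r ^ n * u) \<longlonglongrightarrow> 0 * u"
    using r by (intro tendsto_intros) auto
  then have "(\<lambda>n. char M (r ^ n * u)) \<longlonglongrightarrow> char M 0"
    by (intro isCont_tendsto_compose[OF isCont_char]) auto
  ultimately show ?thesis by (simp add: char_zero LIMSEQ_const_iff)
qed

section \<open>Convolution semigroups\<close>

text \<open>Powers and roots settle rational times, and the right limit at time 0 extends the
  formula to real times. Taking logarithms that are continuous in \<open>u\<close> fixes the branch,
  which the values at a single \<open>u\<close> would leave undetermined.\<close>

lemma semigroup_eq_exp_continuous_log:
  fixes \<phi> :: "real \<Rightarrow> real \<Rightarrow> complex"
  assumes add: "\<And>s t u. 0 \<le> s \<Longrightarrow> 0 \<le> t \<Longrightarrow> \<phi> (s + t) u = \<phi> s u * \<phi> t u"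
    and cont: "\<And>t. 0 \<le> t \<Longrightarrow> continuous_on UNIV (\<phi> t)"
    and zero: "\<And>t. 0 \<le> t \<Longrightarrow> \<phi> t 0 = 1"
    and right: "\<And>u. ((\<lambda>t. \<phi> t u) \<longlongrightarrow> 1) (at_right 0)"
    and t: "0 \<le> t"
  shows "\<phi> t u = exp (of_real t * continuous_log (\<phi> 1) u)" and "\<phi> t u \<noteq> 0"
proof -
  have right_seq: "(\<lambda>n. \<phi> (s n) u) \<longlonglongrightarrow> 1" if "s \<longlonglongrightarrow> 0" "\<And>n. 0 < s n" for s :: "nat \<Rightarrow> real" and u
    using that by (intro filterlim_compose[OF right] tendsto_imp_filterlim_at_right) auto
  \<comment> \<open>Additivity alone gives \<open>\<phi> 0 u * \<phi> s u = \<phi> s u\<close>;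
    letting \<open>s\<close> decrease to 0 excludes the value 0.\<close>
  have \<phi>0: "\<phi> 0 u = 1" for u
  proof -
    have lim: "(\<lambda>n. \<phi> (1 / real (Suc n)) u) \<longlonglongrightarrow> 1"
      by (intro right_seq) (auto intro: LIMSEQ_inverse_real_of_nat simp: divide_inverse simp del: of_nat_Suc)
    have "(\<lambda>n. \<phi> 0 u * \<phi> (1 / real (Suc n)) u) \<longlonglongrightarrow> \<phi> 0 u * 1"
      by (intro tendsto_intros lim)
    moreover have "\<phi> 0 u * \<phi> (1 / real (Suc n)) u = \<phi> (1 / real (Suc n)) u" for n
      using add[of 0 "1 / real (Suc n)" u] by simp
    ultimately have "(\<lambda>n. \<phi> (1 / real (Suc n)) u) \<longlonglongrightarrow> \<phi> 0 u" by (simp only: mult_1_right)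
    with lim show ?thesis by (rule LIMSEQ_unique[symmetric])
  qed
  have pow: "\<phi> (real n * t) u = \<phi> t u ^ n" if "0 \<le> t" for n t u
    using that by (induction n) (auto simp: \<phi>0 add distrib_right)
  \<comment> \<open>A zero at time \<open>t\<close> would be inherited by all times
    \<open>t / Suc n\<close>, against the limit 1 at time 0.\<close>
  have nz: "\<phi> t u \<noteq> 0" if "0 \<le> t" for t u
  proof
    assume 0: "\<phi> t u = 0"
    with \<phi>0 that have "t > 0" by (cases "t = 0") auto
    have "\<phi> (t / real (Suc n)) u = 0" for n
      using pow[of "t / real (Suc n)" "Suc n" u] that 0 by (simp del: of_nat_Suc power_Suc)
    moreover have "(\<lambda>n. \<phi> (t / real (Suc n)) u) \<longlonglongrightarrow> 1"
    proof (rule right_seq)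
      show "(\<lambda>n. t / real (Suc n)) \<longlonglongrightarrow> 0"
        using tendsto_mult[OF tendsto_const[of t] LIMSEQ_inverse_real_of_nat]
        by (simp add: divide_inverse)
    qed (use \<open>t > 0\<close> in auto)
    ultimately show False by (simp add: LIMSEQ_const_iff)
  qed
  show "\<phi> t u \<noteq> 0" using nz t .
  define L where "L t = continuous_log (\<phi> t)" for t
  have L: "continuous_on UNIV (L t)" "L t 0 = 0" "exp (L t u) = \<phi> t u" if "0 \<le> t" for t u
    unfolding L_def using continuous_log[of "\<phi> t"] cont nz zero that by auto
  have L_mult: "L (real n * t) = (\<lambda>u. of_nat n * L t u)" if "0 \<le> t" for n t
    unfolding L_def[of "real n * t"] using that
    by (intro continuous_logI) (auto simp: L pow exp_of_nat_mult intro!: continuous_intros)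
  \<comment> \<open>Both \<open>Suc n\<close> copies of the time \<open>m / Suc n\<close> and
    \<open>m\<close> copies of the time 1 add up to the time \<open>m\<close>, so the logarithms
    agree before exponentiation.\<close>
  have rat: "\<phi> (real m / real (Suc n)) u = exp (of_real (real m / real (Suc n)) * L 1 u)" for m n u
  proof -
    have "of_nat (Suc n) * L (real m / real (Suc n)) u = of_nat m * L 1 u"
      using L_mult[of "real m / real (Suc n)" "Suc n"] L_mult[of 1 m]
      by (simp add: fun_eq_iff del: of_nat_Suc)
    then have "L (real m / real (Suc n)) u = of_real (real m / real (Suc n)) * L 1 u"
      by (simp add: field_simps del: of_nat_Suc)
    with L(3)[of "real m / real (Suc n)" u] show ?thesis by simp
  qed
  \<comment> \<open>Adding 1 to the floor puts the rational \<open>q n\<close> strictly above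
    \<open>t\<close>. Then \<open>q n - t\<close> tends to 0 from the right, and additivity reduces
    continuity at \<open>t\<close> to the limit at time 0.\<close>
  define m where "m n = nat \<lfloor>t * real (Suc n)\<rfloor> + 1" for n
  define q where "q n = real (m n) / real (Suc n)" for n
  have q: "t < q n" "q n - t \<le> inverse (real (Suc n))" for n
  proof -
    have "t * real (Suc n) < real (m n)" "real (m n) \<le> t * real (Suc n) + 1"
    proof -
      have "real (m n) = of_int \<lfloor>t * real (Suc n)\<rfloor> + 1"
        using t by (simp add: m_def)
      then show "t * real (Suc n) < real (m n)" "real (m n) \<le> t * real (Suc n) + 1"
        by linarith+
    qed
    moreover have "q n - t = (real (m n) - t * real (Suc n)) * inverse (real (Suc n))"
      by (simp add: q_def divide_inverse left_diff_distrib del: of_nat_Suc)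
    ultimately have "q n - t > 0" "q n - t \<le> 1 * inverse (real (Suc n))"
      by (auto intro!: mult_pos_pos mult_right_mono simp del: of_nat_Suc)
    then show "t < q n" "q n - t \<le> inverse (real (Suc n))" by simp_all
  qed
  have lim0: "(\<lambda>n. q n - t) \<longlonglongrightarrow> 0"
    by (rule tendsto_sandwich[OF _ _ tendsto_const LIMSEQ_inverse_real_of_nat])
      (use q in \<open>auto simp: less_imp_le\<close>)
  have "(\<lambda>n. \<phi> t u * \<phi> (q n - t) u) \<longlonglongrightarrow> \<phi> t u * 1"
    by (intro tendsto_intros right_seq lim0) (use q in auto)
  moreover have "\<phi> t u * \<phi> (q n - t) u = \<phi> (q n) u" for n
    using add[of t "q n - t" u] t q(1)[of n] by simp
  ultimately have lim1: "(\<lambda>n. \<phi> (q n) u) \<longlonglongrightarrow> \<phi> t u" by simp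
  have "q \<longlonglongrightarrow> t" using lim0 by (simp add: LIM_zero_iff)
  then have "(\<lambda>n. exp (of_real (q n) * L 1 u)) \<longlonglongrightarrow> exp (of_real t * L 1 u)"
    by (intro tendsto_intros)
  then have "(\<lambda>n. \<phi> (q n) u) \<longlonglongrightarrow> exp (of_real t * L 1 u)"
    by (simp add: q_def rat del: of_nat_Suc)
  with lim1 show "\<phi> t u = exp (of_real t * continuous_log (\<phi> 1) u)"
    unfolding L_def by (rule LIMSEQ_unique)
qed

section \<open>Finite-dimensional distributions\<close>

lemma equal_fdds_marginal:
  assumes eq: "equal_fdds M X N Y" and t: "t \<ge> 0"
    and [measurable]: "X t \<in> borel_measurable M" "Y t \<in> borel_measurable N"
  shows "distr M borel (X t) = distr N borel (Y t)"
proof -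
  let ?T = "{t}" and ?p = "\<lambda>x :: real \<Rightarrow> real. x t"
  have "distr M (PiM ?T (\<lambda>_. borel)) (\<lambda>\<omega>. \<lambda>t\<in>?T. X t \<omega>) =
      distr N (PiM ?T (\<lambda>_. borel)) (\<lambda>\<omega>. \<lambda>t\<in>?T. Y t \<omega>)"
    using eq[unfolded equal_fdds_def, rule_format, of ?T] t by simp
  then have "distr (distr M (PiM ?T (\<lambda>_. borel)) (\<lambda>\<omega>. \<lambda>t\<in>?T. X t \<omega>)) borel ?p =
      distr (distr N (PiM ?T (\<lambda>_. borel)) (\<lambda>\<omega>. \<lambda>t\<in>?T. Y t \<omega>)) borel ?p"
    by simp
  moreover have "distr (distr M (PiM ?T (\<lambda>_. borel)) (\<lambda>\<omega>. \<lambda>t\<in>?T. X t \<omega>)) borel ?p = distr M borel (X t)"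
    by (subst distr_distr) (auto simp: comp_def intro!: measurable_restrict)
  moreover have "distr (distr N (PiM ?T (\<lambda>_. borel)) (\<lambda>\<omega>. \<lambda>t\<in>?T. Y t \<omega>)) borel ?p = distr N borel (Y t)"
    by (subst distr_distr) (auto simp: comp_def intro!: measurable_restrict)
  ultimately show ?thesis by simp
qed

text \<open>One clause of \<open>levy_process\<close>, isolated so that it can be stated for the
  time-changed and the rescaled process separately.\<close>

definition indep_increments :: "'a measure \<Rightarrow> (real \<Rightarrow> 'a \<Rightarrow> real) \<Rightarrow> bool" where
  "indep_increments N Z \<longleftrightarrow>
     (\<forall>(n::nat) (t::nat \<Rightarrow> real). 0 \<le> t 0 \<and> (\<forall>i<n. t i \<le> t (Suc i)) \<longrightarrow>
        prob_space.indep_vars N (\<lambda>_. borel) (\<lambda>i \<omega>. Z (t (Suc i)) \<omega> - Z (t i) \<omega>) {..<n})"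

text \<open>Independence makes the joint law of the increments a product measure, and the values of
  the process are partial sums of increments. The right-hand side therefore depends on the process
  only through the laws of single increments. The index \<open>k s\<close> locates the time
  \<open>s\<close> in the grid \<open>t\<close>.\<close>

lemma fdd_eq_increments:
  fixes X :: "real \<Rightarrow> 'a \<Rightarrow> real" and t :: "nat \<Rightarrow> real"
  assumes "prob_space M" and ind: "indep_increments M X"
    and meas: "\<And>t. t \<ge> 0 \<Longrightarrow> X t \<in> borel_measurable M"
    and X0: "AE \<omega> in M. X 0 \<omega> = 0"
    and t: "t 0 = 0" "\<And>i. i < n \<Longrightarrow> t i \<le> t (Suc i)"
    and n: "n > 0" and T: "finite T" "\<And>s. s \<in> T \<Longrightarrow> k s < n \<and> t (k s) = s"
  shows "distr M (PiM T (\<lambda>_. borel)) (\<lambda>\<omega>. \<lambda>s\<in>T. X s \<omega>) =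
    distr (PiM {..<n} (\<lambda>i. distr M borel (\<lambda>\<omega>. X (t (Suc i)) \<omega> - X (t i) \<omega>)))
      (PiM T (\<lambda>_. borel)) (\<lambda>v. \<lambda>s\<in>T. \<Sum>i<k s. v i)"
proof -
  interpret prob_space M by fact
  have tpos: "t i \<ge> 0" if "i \<le> n" for i
    using that
  proof (induction i)
    case (Suc i)
    then show ?case using t(2)[of i] by simp
  qed (simp add: t)
  have Tpos: "s \<ge> 0" if "s \<in> T" for s using T(2)[OF that] tpos[of "k s"] by simp
  let ?D = "\<lambda>i \<omega>. X (t (Suc i)) \<omega> - X (t i) \<omega>"
  have D [measurable]: "?D i \<in> borel_measurable M" if "i < n" for i
    using that tpos by (intro borel_measurable_diff meas) auto
  have "indep_vars (\<lambda>_. borel) ?D {..<n}"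
    using ind t unfolding indep_increments_def by auto
  then have PiM: "PiM {..<n} (\<lambda>i. distr M borel (?D i)) =
      distr M (PiM {..<n} (\<lambda>_. borel)) (\<lambda>\<omega>. \<lambda>i\<in>{..<n}. ?D i \<omega>)"
    using n D by (subst (asm) indep_vars_iff_distr_eq_PiM') auto
  have sum: "(\<Sum>i<k s. (\<lambda>i\<in>{..<n}. ?D i \<omega>) i) = X s \<omega> - X 0 \<omega>" if "s \<in> T" for s \<omega>
  proof -
    have "(\<Sum>i<k s. (\<lambda>i\<in>{..<n}. ?D i \<omega>) i) = (\<Sum>i<k s. ?D i \<omega>)"
      using T(2)[OF that] by (intro sum.cong) auto
    also have "\<dots> = X s \<omega> - X 0 \<omega>"
      using T(2)[OF that] t(1) sum_lessThan_telescope[of "\<lambda>i. X (t i) \<omega>" "k s"] by simp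
    finally show ?thesis .
  qed
  have "distr (PiM {..<n} (\<lambda>i. distr M borel (?D i))) (PiM T (\<lambda>_. borel)) (\<lambda>v. \<lambda>s\<in>T. \<Sum>i<k s. v i) =
      distr M (PiM T (\<lambda>_. borel)) ((\<lambda>v. \<lambda>s\<in>T. \<Sum>i<k s. v i) \<circ> (\<lambda>\<omega>. \<lambda>i\<in>{..<n}. ?D i \<omega>))"
    unfolding PiM
  proof (rule distr_distr)
    show "(\<lambda>v :: nat \<Rightarrow> real. \<lambda>s\<in>T. \<Sum>i<k s. v i) \<in> PiM {..<n} (\<lambda>_. borel) \<rightarrow>\<^sub>M PiM T (\<lambda>_. borel)"
    proof (rule measurable_restrict)
      fix s assume "s \<in> T"
      then have "k s < n" using T(2) by blast
      then show "(\<lambda>v :: nat \<Rightarrow> real. \<Sum>i<k s. v i) \<in> borel_measurable (PiM {..<n} (\<lambda>_. borel))"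
        by - (rule borel_measurable_sum, rule measurable_component_singleton, auto)
    qed
    show "(\<lambda>\<omega>. \<lambda>i\<in>{..<n}. ?D i \<omega>) \<in> M \<rightarrow>\<^sub>M PiM {..<n} (\<lambda>_. borel)"
      using D by (intro measurable_restrict) auto
  qed
  also have "\<dots> = distr M (PiM T (\<lambda>_. borel)) (\<lambda>\<omega>. \<lambda>s\<in>T. X s \<omega> - X 0 \<omega>)"
    unfolding comp_def using sum by (intro arg_cong[where f = "distr _ _"] ext restrict_ext)
  also have "\<dots> = distr M (PiM T (\<lambda>_. borel)) (\<lambda>\<omega>. \<lambda>s\<in>T. X s \<omega>)"
  proof (rule distr_cong_AE)
    show "AE \<omega> in M. (\<lambda>s\<in>T. X s \<omega> - X 0 \<omega>) = (\<lambda>s\<in>T. X s \<omega>)"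
      using X0 by eventually_elim auto
  qed (use Tpos in \<open>auto intro!: measurable_restrict borel_measurable_diff meas\<close>)
  finally show ?thesis by simp
qed

text \<open>Over a common time grid, both finite-dimensional laws are the image of the same product
  measure under the same map.\<close>

lemma equal_fdds_if_increments:
  assumes "prob_space M" "indep_increments M X" "\<And>t. t \<ge> 0 \<Longrightarrow> X t \<in> borel_measurable M"
      "AE \<omega> in M. X 0 \<omega> = 0"
    and "prob_space N" "indep_increments N Y" "\<And>t. t \<ge> 0 \<Longrightarrow> Y t \<in> borel_measurable N"
      "AE \<omega> in N. Y 0 \<omega> = 0"
    and incr: "\<And>s t. 0 \<le> s \<Longrightarrow> s \<le> t \<Longrightarrow>
      distr M borel (\<lambda>\<omega>. X t \<omega> - X s \<omega>) = distr N borel (\<lambda>\<omega>. Y t \<omega> - Y s \<omega>)"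
  shows "equal_fdds M X N Y"
  unfolding equal_fdds_def
proof (intro allI impI, elim conjE)
  fix T :: "real set"
  assume T: "finite T" "T \<subseteq> {0..}"
  \<comment> \<open>The time 0 is added so that the partial sums of increments start from the value
    0.\<close>
  define ts where "ts = sorted_list_of_set (insert 0 T)"
  define n where "n = length ts"
  \<comment> \<open>the last time is repeated, so that even for \<open>T = {}\<close> there is an increment\<close>
  define t where "t i = ts ! min i (n - 1)" for i
  have set_ts: "set ts = insert 0 T" and sorted: "sorted ts"
    using T by (simp_all add: ts_def del: sorted_list_of_set_insert_remove)
  then have "ts \<noteq> []" by auto
  then have n: "n > 0" by (simp add: n_def)
  have mono: "t i \<le> t (Suc i)" for i
    using sorted n by (auto simp: t_def n_def min_def intro!: sorted_nth_mono)
  have t0: "t 0 = 0"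
  proof -
    have "0 \<in> set ts" by (simp add: set_ts)
    then obtain j where "j < n" "ts ! j = 0" by (auto simp: in_set_conv_nth n_def)
    then have "t 0 \<le> 0" using sorted_nth_mono[OF sorted, of 0 j] by (simp add: t_def n_def)
    moreover have "t 0 \<in> set ts" using n by (simp add: t_def n_def)
    ultimately show ?thesis using T set_ts by force
  qed
  have "\<exists>j. j < n \<and> t j = s" if "s \<in> T" for s
  proof -
    have "s \<in> set ts" using that by (simp add: set_ts)
    then obtain j where "j < n" "ts ! j = s" by (auto simp: in_set_conv_nth n_def)
    then show ?thesis by (auto simp: t_def min_def intro!: exI[of _ j])
  qed
  then obtain k where k: "\<And>s. s \<in> T \<Longrightarrow> k s < n \<and> t (k s) = s" by metis
  have tpos: "t i \<ge> 0" for i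
    using lift_Suc_mono_le[of t 0 i] mono t0 by simp
  show "distr M (PiM T (\<lambda>_. borel)) (\<lambda>\<omega>. \<lambda>t\<in>T. X t \<omega>) =
      distr N (PiM T (\<lambda>_. borel)) (\<lambda>\<omega>. \<lambda>t\<in>T. Y t \<omega>)"
    using fdd_eq_increments[OF assms(1-4) t0 mono n T(1) k]
      fdd_eq_increments[OF assms(5-8) t0 mono n T(1) k] incr[OF tpos mono]
    by simp
qed

section \<open>Levy processes\<close>

locale levy = prob_space N for N :: "'b measure" +
  fixes Z :: "real \<Rightarrow> 'b \<Rightarrow> real"
  assumes levy: "levy_process N Z"
begin

lemma measurable_Z: "t \<ge> 0 \<Longrightarrow> random_variable borel (Z t)"
  and Z_0: "AE \<omega> in N. Z 0 \<omega> = 0"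
  and indep_increments: "indep_increments N Z"
  using levy by (auto simp: levy_process_def indep_increments_def)

lemma distr_increment:
  assumes "0 \<le> s" "s \<le> t"
  shows "distr N borel (\<lambda>\<omega>. Z t \<omega> - Z s \<omega>) = distr N borel (Z (t - s))"
proof -
  have "\<forall>s\<ge>0. \<forall>t\<ge>0. distr N borel (\<lambda>\<omega>. Z (s + t) \<omega> - Z s \<omega>) = distr N borel (\<lambda>\<omega>. Z t \<omega> - Z 0 \<omega>)"
    using levy by (simp add: levy_process_def)
  from this[rule_format, of s "t - s"] assms
  have "distr N borel (\<lambda>\<omega>. Z t \<omega> - Z s \<omega>) = distr N borel (\<lambda>\<omega>. Z (t - s) \<omega> - Z 0 \<omega>)"
    by simp
  also have "\<dots> = distr N borel (Z (t - s))"
  proof (rule distr_cong_AE)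
    show "AE \<omega> in N. Z (t - s) \<omega> - Z 0 \<omega> = Z (t - s) \<omega>" using Z_0 by eventually_elim simp
  qed (use assms in \<open>auto intro!: borel_measurable_diff measurable_Z\<close>)
  finally show ?thesis .
qed

definition \<phi> :: "real \<Rightarrow> real \<Rightarrow> complex" where
  "\<phi> t = char (distr N borel (Z t))"

lemma real_distribution_Z: "t \<ge> 0 \<Longrightarrow> real_distribution (distr N borel (Z t))"
  by (simp add: measurable_Z)

lemma \<phi>_add:
  assumes "0 \<le> s" "0 \<le> t"
  shows "\<phi> (s + t) u = \<phi> s u * \<phi> t u"
proof -
  \<comment> \<open>A grid with two increments, from 0 to \<open>s\<close> and from \<open>s\<close>
    to \<open>s + t\<close>.\<close>
  let ?t = "\<lambda>i::nat. if i = 0 then 0 else if i = 1 then s else s + t"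
  have "indep_vars (\<lambda>_. borel) (\<lambda>i \<omega>. Z (?t (Suc i)) \<omega> - Z (?t i) \<omega>) {..<2}"
    by (rule indep_increments[unfolded indep_increments_def, rule_format]) (use assms in auto)
  then have "char (distr N borel (\<lambda>\<omega>. \<Sum>i<2. Z (?t (Suc i)) \<omega> - Z (?t i) \<omega>)) u =
      (\<Prod>i<2. char (distr N borel (\<lambda>\<omega>. Z (?t (Suc i)) \<omega> - Z (?t i) \<omega>)) u)"
    by (rule char_distr_sum)
  then have "char (distr N borel (\<lambda>\<omega>. Z (s + t) \<omega> - Z 0 \<omega>)) u =
      char (distr N borel (\<lambda>\<omega>. Z s \<omega> - Z 0 \<omega>)) u * char (distr N borel (\<lambda>\<omega>. Z (s + t) \<omega> - Z s \<omega>)) u"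
    by (simp add: numeral_2_eq_2)
  then show ?thesis
    using distr_increment[of 0 s] distr_increment[of 0 "s + t"] distr_increment[of s "s + t"] assms
    by (simp add: \<phi>_def)
qed

lemma \<phi>_continuous: "t \<ge> 0 \<Longrightarrow> continuous_on UNIV (\<phi> t)"
  unfolding \<phi>_def
  by (intro continuous_at_imp_continuous_on ballI real_distribution.isCont_char real_distribution_Z)

lemma \<phi>_zero: "t \<ge> 0 \<Longrightarrow> \<phi> t 0 = 1"
  unfolding \<phi>_def by (intro real_distribution.char_zero real_distribution_Z)

text \<open>This is where continuity in probability enters, at time 0.\<close>

lemma \<phi>_right: "((\<lambda>t. \<phi> t u) \<longlongrightarrow> 1) (at_right 0)"
proof (rule tendstoI)
  fix d :: real assume d: "d > 0"
  \<comment> \<open>The threshold keeps the first term of the bound at most \<open>d / 2\<close>,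
    also for \<open>u = 0\<close>; a probability below \<open>d / 4\<close> keeps the second term
    below \<open>d / 2\<close>.\<close>
  define e where "e = d / (2 * (\<bar>u\<bar> + 1))"
  have e: "e > 0" using d by (simp add: e_def add_nonneg_pos)
  have "\<bar>u\<bar> * e \<le> d / 2"
    using d by (simp add: e_def field_simps)
  have "((\<lambda>t. prob {\<omega> \<in> space N. \<bar>Z t \<omega> - Z 0 \<omega>\<bar> > e}) \<longlongrightarrow> 0) (at 0 within {0..})"
    using levy e by (simp add: levy_process_def)
  then have "((\<lambda>t. prob {\<omega> \<in> space N. \<bar>Z t \<omega> - Z 0 \<omega>\<bar> > e}) \<longlongrightarrow> 0) (at_right 0)"
    by (rule tendsto_within_subset) auto
  then have "\<forall>\<^sub>F t in at_right 0. prob {\<omega> \<in> space N. \<bar>Z t \<omega> - Z 0 \<omega>\<bar> > e} < d / 4"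
    using d by (intro order_tendstoD) auto
  moreover have "\<forall>\<^sub>F t in at_right (0::real). t > 0" by (rule eventually_at_right_less)
  ultimately show "\<forall>\<^sub>F t in at_right 0. dist (\<phi> t u) 1 < d"
  proof eventually_elim
    case (elim t)
    have "dist (\<phi> t u) 1 = norm (char (distr N borel (\<lambda>\<omega>. Z t \<omega> - Z 0 \<omega>)) u - 1)"
      using elim distr_increment[of 0 t] by (simp add: \<phi>_def dist_norm)
    also have "\<dots> \<le> \<bar>u\<bar> * e + 2 * prob {\<omega> \<in> space N. \<bar>Z t \<omega> - Z 0 \<omega>\<bar> > e}"
      using elim e by (intro norm_char_minus_1_le borel_measurable_diff measurable_Z) auto
    also have "\<dots> < d" using elim \<open>\<bar>u\<bar> * e \<le> d / 2\<close> by simp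
    finally show ?case .
  qed
qed

lemmas \<phi>_eq_exp = semigroup_eq_exp_continuous_log(1)[of \<phi>, OF \<phi>_add \<phi>_continuous \<phi>_zero \<phi>_right]
lemmas \<phi>_nonzero = semigroup_eq_exp_continuous_log(2)[of \<phi>, OF \<phi>_add \<phi>_continuous \<phi>_zero \<phi>_right]

lemma indep_increments_time_change:
  assumes "c \<ge> 0"
  shows "indep_increments N (\<lambda>t. Z (c * t))"
  unfolding indep_increments_def
proof (intro allI impI, elim conjE)
  fix n and t :: "nat \<Rightarrow> real"
  assume "0 \<le> t 0" "\<forall>i<n. t i \<le> t (Suc i)"
  then show "indep_vars (\<lambda>_. borel) (\<lambda>i \<omega>. Z (c * t (Suc i)) \<omega> - Z (c * t i) \<omega>) {..<n}"
    using indep_increments[unfolded indep_increments_def, rule_format, of "\<lambda>i. c * t i" n] assms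
    by (auto intro: mult_left_mono)
qed

lemma indep_increments_scale: "indep_increments N (\<lambda>t \<omega>. c * Z t \<omega>)"
  unfolding indep_increments_def
proof (intro allI impI)
  fix n and t :: "nat \<Rightarrow> real"
  assume "0 \<le> t 0 \<and> (\<forall>i<n. t i \<le> t (Suc i))"
  then have "indep_vars (\<lambda>_. borel) (\<lambda>i \<omega>. Z (t (Suc i)) \<omega> - Z (t i) \<omega>) {..<n}"
    using indep_increments unfolding indep_increments_def by blast
  then have "indep_vars (\<lambda>_. borel) (\<lambda>i \<omega>. c * (Z (t (Suc i)) \<omega> - Z (t i) \<omega>)) {..<n}"
    by (rule indep_vars_compose2[where Y = "\<lambda>_ x. c * x"]) auto
  then show "indep_vars (\<lambda>_. borel) (\<lambda>i \<omega>. c * Z (t (Suc i)) \<omega> - c * Z (t i) \<omega>) {..<n}"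
    by (simp add: right_diff_distrib)
qed

lemma distr_scaling_iff:
  assumes "c \<ge> 0" "t \<ge> 0"
  shows "distr N borel (Z (c * t)) = distr N borel (\<lambda>\<omega>. k * Z t \<omega>) \<longleftrightarrow>
    (\<forall>u. \<phi> (c * t) u = \<phi> t (k * u))"
proof -
  have Z [measurable]: "random_variable borel (Z t)" "random_variable borel (Z (c * t))"
    using assms by (simp_all add: measurable_Z)
  have "random_variable borel (\<lambda>\<omega>. k * Z t \<omega>)" by measurable
  then show ?thesis
    using Z by (simp add: distr_eq_iff_char prob_space_axioms char_distr_scale \<phi>_def)
qed

text \<open>One direction restricts to single times. Conversely, stationarity reduces an increment
  from \<open>s\<close> to \<open>t\<close> to the value at time \<open>t - s\<close>, so scaling at
  single times passes to increments and hence to all finite-dimensional laws.\<close>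

lemma equal_fdds_scaling_iff:
  assumes c: "c \<ge> 0"
  shows "equal_fdds N (\<lambda>t. Z (c * t)) N (\<lambda>t \<omega>. k * Z t \<omega>) \<longleftrightarrow>
    (\<forall>t\<ge>0. \<forall>u. \<phi> (c * t) u = \<phi> t (k * u))"
proof
  assume eq: "equal_fdds N (\<lambda>t. Z (c * t)) N (\<lambda>t \<omega>. k * Z t \<omega>)"
  show "\<forall>t\<ge>0. \<forall>u. \<phi> (c * t) u = \<phi> t (k * u)"
  proof (intro allI impI)
    fix t u :: real assume t: "t \<ge> 0"
    have "distr N borel (Z (c * t)) = distr N borel (\<lambda>\<omega>. k * Z t \<omega>)"
      using t c by (intro equal_fdds_marginal[OF eq t] borel_measurable_times measurable_Z) auto
    then show "\<phi> (c * t) u = \<phi> t (k * u)" using distr_scaling_iff[OF c t] by simp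
  qed
next
  assume \<phi>: "\<forall>t\<ge>0. \<forall>u. \<phi> (c * t) u = \<phi> t (k * u)"
  show "equal_fdds N (\<lambda>t. Z (c * t)) N (\<lambda>t \<omega>. k * Z t \<omega>)"
  proof (rule equal_fdds_if_increments)
    fix s t :: real assume st: "0 \<le> s" "s \<le> t"
    have "distr N borel (\<lambda>\<omega>. Z (c * t) \<omega> - Z (c * s) \<omega>) = distr N borel (Z (c * (t - s)))"
      using st c distr_increment[of "c * s" "c * t"] by (simp add: mult_left_mono right_diff_distrib)
    also have "\<dots> = distr N borel (\<lambda>\<omega>. k * Z (t - s) \<omega>)"
      using \<phi> st c by (subst distr_scaling_iff) auto
    \<comment> \<open>The factor \<open>k\<close> is moved into an image measure so that
      stationarity can be applied to the unscaled law.\<close>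
    also have "\<dots> = distr (distr N borel (Z (t - s))) borel (\<lambda>x. k * x)"
      using st by (subst distr_distr) (auto simp: comp_def measurable_Z)
    also have "\<dots> = distr (distr N borel (\<lambda>\<omega>. Z t \<omega> - Z s \<omega>)) borel (\<lambda>x. k * x)"
      using distr_increment st by simp
    also have "\<dots> = distr N borel (\<lambda>\<omega>. k * Z t \<omega> - k * Z s \<omega>)"
      using st by (subst distr_distr)
        (auto simp: comp_def right_diff_distrib intro!: borel_measurable_diff measurable_Z)
    finally show "distr N borel (\<lambda>\<omega>. Z (c * t) \<omega> - Z (c * s) \<omega>) =
      distr N borel (\<lambda>\<omega>. k * Z t \<omega> - k * Z s \<omega>)" .
  next
    show "AE \<omega> in N. Z (c * 0) \<omega> = 0" using Z_0 by simp
    show "AE \<omega> in N. k * Z 0 \<omega> = 0" using Z_0 by eventually_elim simp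
  qed (use c in \<open>auto intro!: prob_space_axioms indep_increments_time_change indep_increments_scale
        borel_measurable_times measurable_Z\<close>)
qed

text \<open>If the factors differed, the law of \<open>Z t\<close> would be invariant under scaling
  by their ratio, taken below 1, and so be concentrated at 0. This supplies uniqueness of the
  exponent.\<close>

lemma scaling_factor_unique:
  assumes t: "t \<ge> 0" "\<not> (AE \<omega> in N. Z t \<omega> = 0)"
    and k: "k > 0" "k' > 0" and eq: "\<And>u. \<phi> t (k * u) = \<phi> t (k' * u)"
  shows "k = k'"
proof -
  interpret D: real_distribution "distr N borel (Z t)" by (rule real_distribution_Z[OF t(1)])
  have *: False if "0 < k" "k < k'" "\<And>u. \<phi> t (k * u) = \<phi> t (k' * u)" for k k'
  proof -
    have "\<phi> t ((k / k') * u) = \<phi> t u" for u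
      using that(3)[of "u / k'"] that by simp
    then have "char (distr N borel (Z t)) u = 1" for u
      unfolding \<phi>_def
      by (intro D.char_eq_1_if_scale_invariant[of "k / k'"]) (use that in auto)
    then show False using AE_eq_0_if_char_eq_1[OF measurable_Z[OF t(1)]] t(2) by blast
  qed
  show ?thesis
    using *[of k k'] *[of k' k] k eq by (cases k k' rule: linorder_cases) auto
qed

text \<open>By the exponential formula, \<open>cf_power (\<phi> 1) a\<close> is the characteristic
  function at time \<open>a\<close>, so the power in the definition becomes a time of the
  process.\<close>

lemma semi_stable_iff:
  assumes "0 < b" "b < 1" "0 < \<alpha>" "\<alpha> \<le> 2" "a = b powr (- \<alpha>)"
  shows "semi_stable a b (distr N borel (Z 1)) \<longleftrightarrow> (\<forall>u. \<phi> 1 u = \<phi> a (b * u))"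
proof -
  have a: "a > 1" "a * b powr \<alpha> = 1"
    using assms powr_less_mono2_neg[of "- \<alpha>" b 1] by (auto simp: powr_minus)
  then have "cf_power (\<phi> 1) a u = \<phi> a u" for u
    by (simp add: cf_power_def \<phi>_eq_exp)
  then show ?thesis
    using assms a real_distribution_Z[of 1] \<phi>_nonzero[of 1]
    unfolding semi_stable_def \<phi>_def[symmetric] by auto
qed

text \<open>Equality of exponentials at time 1 does not by itself permit real powers. Since
  \<open>a * L (b * u)\<close> is continuous in \<open>u\<close> and vanishes at 0, it is the
  continuous logarithm itself, and the identity of logarithms can be multiplied by
  \<open>t\<close>.\<close>

lemma scaling_all_times:
  assumes a: "a \<ge> 0" and eq: "\<And>u. \<phi> 1 u = \<phi> a (b * u)"
    and "t \<ge> 0"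
  shows "\<phi> t u = \<phi> (a * t) (b * u)"
proof -
  let ?L = "continuous_log (\<phi> 1)"
  have L: "continuous_on UNIV ?L" "?L 0 = 0"
    using continuous_log[of "\<phi> 1"] \<phi>_continuous[of 1] \<phi>_nonzero[of 1] \<phi>_zero[of 1] by auto
  have "?L = (\<lambda>u. of_real a * ?L (b * u))"
    by (rule continuous_logI)
      (use L a in \<open>auto simp: eq \<phi>_eq_exp[of a] intro!: continuous_intros continuous_on_compose2[OF L(1)]\<close>)
  then have "?L u = of_real a * ?L (b * u)" by (rule fun_cong)
  then show ?thesis using assms by (simp add: \<phi>_eq_exp[of t] \<phi>_eq_exp[of "a * t"] mult_ac)
qed

end

section \<open>The autoregressive scheme\<close>

lemma ar1_char_step:
  assumes ar: "ar1_scheme M b X \<epsilon>" and n: "n \<ge> 1"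
  shows "char (distr M borel (X n)) u =
    char (distr M borel (X (n - 1))) (b * u) * char (distr M borel (\<epsilon> n)) u"
proof -
  interpret prob_space M using ar by (simp add: ar1_scheme_def)
  have X [measurable]: "random_variable borel (X n)" for n
    using ar by (simp add: ar1_scheme_def)
  have ind: "indep_var borel (X (n - 1)) borel (\<epsilon> n)" and AE: "AE \<omega> in M. X n \<omega> = b * X (n - 1) \<omega> + \<epsilon> n \<omega>"
    using ar n by (auto simp: ar1_scheme_def)
  have [measurable]: "random_variable borel (\<epsilon> n)" using ind by (rule indep_var_rv2)
  have ind': "indep_var borel (\<lambda>\<omega>. b * X (n - 1) \<omega>) borel (\<epsilon> n)"
    using indep_var_compose[OF ind, of "\<lambda>x. b * x" borel "\<lambda>x. x" borel]
    unfolding comp_def by measurable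
  have "distr M borel (X n) = distr M borel (\<lambda>\<omega>. b * X (n - 1) \<omega> + \<epsilon> n \<omega>)"
    using AE by (intro distr_cong_AE) auto
  then show ?thesis
    using char_distr_add[OF ind', of u] by (simp add: char_distr_scale)
qed

text \<open>The premise on \<open>Z\<close> in the converse excludes a process vanishing almost
  surely at each time: there every exponent satisfies the scaling relation, and the uniqueness
  demanded by \<open>semi_selfsimilar\<close> fails.\<close>

theorem theorem2p3:
  fixes M :: "'a measure" and N :: "'b measure"
    and X \<epsilon> :: "nat \<Rightarrow> 'a \<Rightarrow> real" and Z :: "real \<Rightarrow> 'b \<Rightarrow> real"
    and a b \<alpha> :: real
  assumes "0 < b" "b < 1" "0 < \<alpha>" "\<alpha> \<le> 2" "a = b powr (- \<alpha>)"
    and "ar1_scheme M b X \<epsilon>"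
    and "levy_process N Z"
    and "distr M borel (X 0) = distr N borel (Z 1)"
    and "\<forall>n\<ge>1. distr M borel (\<epsilon> n) = distr N borel (\<lambda>\<omega>. b * Z (b powr (- \<alpha>) - 1) \<omega>)"
  shows "(semi_selfsimilar N Z (b powr (- \<alpha>)) (1 / \<alpha>) \<longrightarrow>
            marginally_stationary M X \<and> (\<forall>n. semi_stable a b (distr M borel (X n)))) \<and>
         (marginally_stationary M X \<longrightarrow>
            ((\<exists>t\<ge>0. \<not> (AE \<omega> in N. Z t \<omega> = 0)) \<longrightarrow> semi_selfsimilar N Z (b powr (- \<alpha>)) (1 / \<alpha>)) \<and>
            (\<forall>n. semi_stable a b (distr M borel (X n))))"
proof -
  interpret levy N Z
    using \<open>levy_process N Z\<close> by (auto simp: levy_def levy_axioms_def levy_process_def)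
  have "prob_space M" and X: "\<And>n. X n \<in> borel_measurable M"
    using assms(6) by (auto simp: ar1_scheme_def)
  have a: "a > 1" using assms(1-5) powr_less_mono2_neg[of "- \<alpha>" b 1] by simp
  have a_powr: "a powr (1 / \<alpha>) = 1 / b"
    unfolding assms(5) using assms(1,3) by (simp add: powr_powr)
  have stable: "semi_stable a b (distr N borel (Z 1)) \<longleftrightarrow> (\<forall>u. \<phi> 1 u = \<phi> a (b * u))"
    using assms(1-5) by (rule semi_stable_iff)
  have step: "char (distr M borel (X (Suc n))) u = \<phi> a (b * u)"
    if "distr M borel (X n) = distr N borel (Z 1)" for n u
  proof -
    \<comment> \<open>The factor \<open>b\<close> in the innovation law produces the same argument
      \<open>b * u\<close> as the autoregression does, so that the times 1 and \<open>a - 1\<close>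
      add up.\<close>
    have "char (distr M borel (\<epsilon> (Suc n))) u = \<phi> (a - 1) (b * u)"
      using assms(5,9) a by (simp add: char_distr_scale measurable_Z \<phi>_def)
    then have "char (distr M borel (X (Suc n))) u = \<phi> 1 (b * u) * \<phi> (a - 1) (b * u)"
      using ar1_char_step[OF assms(6), of "Suc n" u] that by (simp add: \<phi>_def)
    also have "\<dots> = \<phi> a (b * u)" using \<phi>_add[of 1 "a - 1" "b * u"] a by simp
    finally show ?thesis .
  qed
  have forward: "marginally_stationary M X \<and> (\<forall>n. semi_stable a b (distr M borel (X n)))"
    if "semi_selfsimilar N Z a (1 / \<alpha>)"
  proof -
    have "equal_fdds N (\<lambda>t. Z (a * t)) N (\<lambda>t \<omega>. 1 / b * Z t \<omega>)"
      using that unfolding semi_selfsimilar_def a_powr by blast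
    then have "\<forall>t\<ge>0. \<forall>u. \<phi> (a * t) u = \<phi> t (1 / b * u)"
      using a by (subst (asm) equal_fdds_scaling_iff) auto
    from this[rule_format, of 1 "b * u" for u]
    have eq: "\<phi> a (b * u) = \<phi> 1 u" for u using assms(1) by simp
    have "distr M borel (X n) = distr N borel (Z 1)" for n
    proof (induction n)
      case (Suc n)
      show ?case
        using step[OF Suc.IH] eq \<open>prob_space M\<close> X prob_space_axioms measurable_Z[of 1]
        by (subst distr_eq_iff_char) (auto simp: \<phi>_def)
    qed (rule assms(8))
    then show ?thesis using stable eq by (simp add: marginally_stationary_def)
  qed
  have backward: "((\<exists>t\<ge>0. \<not> (AE \<omega> in N. Z t \<omega> = 0)) \<longrightarrow> semi_selfsimilar N Z a (1 / \<alpha>)) \<and>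
      (\<forall>n. semi_stable a b (distr M borel (X n)))" if "marginally_stationary M X"
  proof -
    have law: "distr M borel (X n) = distr N borel (Z 1)" for n
      using that assms(8) unfolding marginally_stationary_def by metis
    \<comment> \<open>The transition from \<open>X 0\<close> to \<open>X 1\<close> already yields
      the identity.\<close>
    have eq: "\<phi> 1 u = \<phi> a (b * u)" for u
      using step[OF law, of 0 u] law[of "Suc 0"] by (simp add: \<phi>_def)
    have scaling: "\<phi> (a * t) u = \<phi> t (a powr (1 / \<alpha>) * u)" if "t \<ge> 0" for t u
      using scaling_all_times[of a b t "1 / b * u"] a eq that assms(1) by (simp add: a_powr)
    have "semi_selfsimilar N Z a (1 / \<alpha>)" if t: "t \<ge> 0" "\<not> (AE \<omega> in N. Z t \<omega> = 0)" for t
      unfolding semi_selfsimilar_def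
    proof (intro conjI allI impI)
      show "equal_fdds N (\<lambda>t. Z (a * t)) N (\<lambda>t \<omega>. a powr (1 / \<alpha>) * Z t \<omega>)"
        using a scaling by (subst equal_fdds_scaling_iff) auto
      \<comment> \<open>A competing exponent is tested at the time \<open>t\<close> where
        \<open>Z\<close> is not almost surely 0; equal factors give equal exponents because
        \<open>a > 1\<close>.\<close>
      fix H' assume "equal_fdds N (\<lambda>t. Z (a * t)) N (\<lambda>t \<omega>. a powr H' * Z t \<omega>)"
      then have "\<phi> t (a powr (1 / \<alpha>) * u) = \<phi> t (a powr H' * u)" for u
        using a t scaling by (subst (asm) equal_fdds_scaling_iff) auto
      then have "a powr (1 / \<alpha>) = a powr H'"
        using a by (intro scaling_factor_unique[OF t]) auto
      then show "H' = 1 / \<alpha>" using a by (simp add: powr_inj)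
    qed (use a assms(3) in auto)
    moreover have "semi_stable a b (distr N borel (Z 1))" using stable eq by blast
    ultimately show ?thesis using law by auto
  qed
  show ?thesis using forward backward assms(5) by simp
qed

end
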